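(* Let $\psi\in\mathcal{D}$ be a DQBF and let $\forall x:\varphi$ be a subformula of $\psi$ with $x\notin V_\varphi$. Let $\psi'$ result from $\psi$ by replacing the subformula $\forall x:\varphi$ by $\varphi^{-x}$ (the formula $\varphi$ with $x$ removed from the dependency sets of all existential variables of $\varphi$). Then $\psi$ and $\psi'$ are equisatisfiable.
   Context: Notation: $\mathcal{F}(W)$ is the set of Boolean functions over variable set $W$; $\mathrm{supp}(f)$ the set of variables $f$ depends on. Syntax (non-closed non-prenex DQBFs in NNF over a finite variable set $V$). The set $\mathcal{D}$, with for each $\psi$ the sets $V^{\exists}_\psi$ (existential), $V^{\forall}_\psi$ (universal), $V^{\mathrm{fs}}_\psi$ (free variables occurring in $\psi$), and a dependency set $D_y\subseteq V$ for each existential $y$, is the smallest set closed under: (1) $v\in\mathcal{D}$ for $v\in V$ ($V^\exists=V^\forall=\emptyset$, $V^{\mathrm{fs}}=\{v\}$); (2) $\neg v\in\mathcal{D}$, same sets; (3),(4) if $\varphi_1,\varphi_2\in\mathcal{D}$ and $\bigl(V^Q_{\varphi_1}\cup V^{\mathrm{fs}}_{\varphi_1}\cup\bigcup_{y\in V^\exists_{\varphi_1}}D_y\bigr)\cap V^Q_{\varphi_2}=\emptyset$ and symmetrically, then $(\varphi_1\wedge\varphi_2),(\varphi_1\vee\varphi_2)\in\mathcal{D}$ with all three sets the unions; (5) if $\varphi\in\mathcal{D}$, $v\in V^{\mathrm{free}}_\varphi$, $D_v\subseteq V\setminus(V^Q_\varphi\cup\{v\})$, then $\exists v(D_v):\varphi^{-v}\in\mathcal{D}$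 ($\varphi^{-v}$: remove $v$ from all dependency sets in $\varphi$), with $V^\exists=V^\exists_\varphi\cup\{v\}$, $V^{\mathrm{fs}}=V^{\mathrm{fs}}_\varphi\setminus\{v\}$; (6) if $\varphi\in\mathcal{D}$, $v\in V^{\mathrm{free}}_\varphi$, then $\forall v:\varphi\in\mathcal{D}$ with $V^\forall=V^\forall_\varphi\cup\{v\}$, $V^{\mathrm{fs}}=V^{\mathrm{fs}}_\varphi\setminus\{v\}$. Here $V^Q_\psi=V^\exists_\psi\cup V^\forall_\psi$, $V_\psi=V^Q_\psi\cup V^{\mathrm{fs}}_\psi$, $V^{\mathrm{free}}_\psi=V\setminus V^Q_\psi$. Semantics. A Skolem function candidate for $\psi$ is a map $s:V^{\mathrm{free}}_\psi\cup V^\exists_\psi\to\mathcal{F}(V^\forall_\psi)$ with $s(v)$ constant for free $v$ and $\mathrm{supp}(s(v))\subseteq D_v\cap V^\forall_\psi$ for existential $v$. $s(\psi)$ replaces each such $v$ by $s(v)$ and deletes quantifiers. $[\![\psi]\!]$ is the set of candidates $s$ with $s(\psi)$ a tautology. $\psi_1\approx\psi_2$ (equisatisfiable) iff $[\![\psi_1]\!]=\emptyset\Leftrightarrow[\![\psi_2]\!]=\emptyset$. *)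

theory Defs
  imports Main "HOL-Library.FuncSet"
begin

text \<open>Quantified formulas in negation normal form. An existential quantifier carries its
  dependency set; well-formedness is imposed separately by \<open>dqbfs\<close>.\<close>

datatype 'v dqbf =
    Var 'v
  | NVar 'v
  | Conj "'v dqbf" "'v dqbf"
  | Disj "'v dqbf" "'v dqbf"
  | Exists 'v "'v set" "'v dqbf"
  | Forall 'v "'v dqbf"

primrec ex_vars :: "'v dqbf \<Rightarrow> 'v set" where
  "ex_vars (Var v) = {}"
| "ex_vars (NVar v) = {}"
| "ex_vars (Conj \<phi>1 \<phi>2) = ex_vars \<phi>1 \<union> ex_vars \<phi>2"
| "ex_vars (Disj \<phi>1 \<phi>2) = ex_vars \<phi>1 \<union> ex_vars \<phi>2"
| "ex_vars (Exists v D \<phi>) = ex_vars \<phi> \<union> {v}"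
| "ex_vars (Forall v \<phi>) = ex_vars \<phi>"

primrec all_vars :: "'v dqbf \<Rightarrow> 'v set" where
  "all_vars (Var v) = {}"
| "all_vars (NVar v) = {}"
| "all_vars (Conj \<phi>1 \<phi>2) = all_vars \<phi>1 \<union> all_vars \<phi>2"
| "all_vars (Disj \<phi>1 \<phi>2) = all_vars \<phi>1 \<union> all_vars \<phi>2"
| "all_vars (Exists v D \<phi>) = all_vars \<phi>"
| "all_vars (Forall v \<phi>) = all_vars \<phi> \<union> {v}"

text \<open>Free variables that occur in the matrix; dependency sets do not count as occurrences.\<close>

primrec fs_vars :: "'v dqbf \<Rightarrow> 'v set" where
  "fs_vars (Var v) = {v}"
| "fs_vars (NVar v) = {v}"
| "fs_vars (Conj \<phi>1 \<phi>2) = fs_vars \<phi>1 \<union> fs_vars \<phi>2"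
| "fs_vars (Disj \<phi>1 \<phi>2) = fs_vars \<phi>1 \<union> fs_vars \<phi>2"
| "fs_vars (Exists v D \<phi>) = fs_vars \<phi> - {v}"
| "fs_vars (Forall v \<phi>) = fs_vars \<phi> - {v}"

definition q_vars :: "'v dqbf \<Rightarrow> 'v set" where
  "q_vars \<psi> = ex_vars \<psi> \<union> all_vars \<psi>"

definition vars :: "'v dqbf \<Rightarrow> 'v set" where
  "vars \<psi> = q_vars \<psi> \<union> fs_vars \<psi>"

text \<open>All variables of the ambient set \<open>V\<close> that are not quantified, whether or not they occur.\<close>

definition free_vars :: "'v set \<Rightarrow> 'v dqbf \<Rightarrow> 'v set" where
  "free_vars V \<psi> = V - q_vars \<psi>"

text \<open>\<open>dep \<psi> y\<close> is the dependency set of \<open>y\<close> in \<open>\<psi>\<close>, and empty if \<open>y\<close> is not existential in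
  \<open>\<psi>\<close>. In a well-formed formula every quantified variable has exactly one quantifier, so at
  most one side of each union below is nonempty.\<close>

primrec dep :: "'v dqbf \<Rightarrow> 'v \<Rightarrow> 'v set" where
  "dep (Var v) y = {}"
| "dep (NVar v) y = {}"
| "dep (Conj \<phi>1 \<phi>2) y = dep \<phi>1 y \<union> dep \<phi>2 y"
| "dep (Disj \<phi>1 \<phi>2) y = dep \<phi>1 y \<union> dep \<phi>2 y"
| "dep (Exists v D \<phi>) y = (if y = v then D else dep \<phi> y)"
| "dep (Forall v \<phi>) y = dep \<phi> y"

text \<open>The operation written \<open>\<phi>\<close> with superscript \<open>-v\<close>.\<close>

primrec remove_dep :: "'v \<Rightarrow> 'v dqbf \<Rightarrow> 'v dqbf" where
  "remove_dep v (Var w) = Var w"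
| "remove_dep v (NVar w) = NVar w"
| "remove_dep v (Conj \<phi>1 \<phi>2) = Conj (remove_dep v \<phi>1) (remove_dep v \<phi>2)"
| "remove_dep v (Disj \<phi>1 \<phi>2) = Disj (remove_dep v \<phi>1) (remove_dep v \<phi>2)"
| "remove_dep v (Exists y D \<phi>) = Exists y (D - {v}) (remove_dep v \<phi>)"
| "remove_dep v (Forall w \<phi>) = Forall w (remove_dep v \<phi>)"

definition separated :: "'v dqbf \<Rightarrow> 'v dqbf \<Rightarrow> bool" where
  "separated \<phi>1 \<phi>2 \<longleftrightarrow>
     (q_vars \<phi>1 \<union> fs_vars \<phi>1 \<union> (\<Union>y\<in>ex_vars \<phi>1. dep \<phi>1 y)) \<inter> q_vars \<phi>2 = {}"

inductive_set dqbfs :: "'v set \<Rightarrow> 'v dqbf set" for V :: "'v set" where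
  Var: "v \<in> V \<Longrightarrow> Var v \<in> dqbfs V"
| NVar: "v \<in> V \<Longrightarrow> NVar v \<in> dqbfs V"
| Conj: "\<lbrakk>\<phi>1 \<in> dqbfs V; \<phi>2 \<in> dqbfs V; separated \<phi>1 \<phi>2; separated \<phi>2 \<phi>1\<rbrakk>
    \<Longrightarrow> Conj \<phi>1 \<phi>2 \<in> dqbfs V"
| Disj: "\<lbrakk>\<phi>1 \<in> dqbfs V; \<phi>2 \<in> dqbfs V; separated \<phi>1 \<phi>2; separated \<phi>2 \<phi>1\<rbrakk>
    \<Longrightarrow> Disj \<phi>1 \<phi>2 \<in> dqbfs V"
| Exists: "\<lbrakk>\<phi> \<in> dqbfs V; v \<in> free_vars V \<phi>; D \<subseteq> V - (q_vars \<phi> \<union> {v})\<rbrakk>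
    \<Longrightarrow> Exists v D (remove_dep v \<phi>) \<in> dqbfs V"
| Forall: "\<lbrakk>\<phi> \<in> dqbfs V; v \<in> free_vars V \<phi>\<rbrakk> \<Longrightarrow> Forall v \<phi> \<in> dqbfs V"

text \<open>A Boolean function over \<open>W\<close> is represented by a function on total assignments whose value
  is determined by the restriction of the assignment to \<open>W\<close>.\<close>

type_synonym 'v boolfun = "('v \<Rightarrow> bool) \<Rightarrow> bool"

definition boolfuns :: "'v set \<Rightarrow> 'v boolfun set" where
  "boolfuns W = {f. \<forall>a b. (\<forall>w\<in>W. a w = b w) \<longrightarrow> f a = f b}"

definition supp :: "'v boolfun \<Rightarrow> 'v set" where
  "supp f = {v. \<exists>a. f (a(v := True)) \<noteq> f (a(v := False))}"

definition skolem_candidates :: "'v set \<Rightarrow> 'v dqbf \<Rightarrow> ('v \<Rightarrow> 'v boolfun) set" where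
  "skolem_candidates V \<psi> =
     {s \<in> (free_vars V \<psi> \<union> ex_vars \<psi>) \<rightarrow>\<^sub>E boolfuns (all_vars \<psi>).
        (\<forall>v\<in>free_vars V \<psi>. \<exists>c. s v = (\<lambda>_. c)) \<and>
        (\<forall>v\<in>ex_vars \<psi>. supp (s v) \<subseteq> dep \<psi> v \<inter> all_vars \<psi>)}"

text \<open>\<open>matrix_fun t \<psi>\<close> is the Boolean function obtained by deleting the quantifiers of \<open>\<psi>\<close> and
  substituting \<open>t v\<close> for every variable \<open>v\<close> of the matrix.\<close>

primrec matrix_fun :: "('v \<Rightarrow> 'v boolfun) \<Rightarrow> 'v dqbf \<Rightarrow> 'v boolfun" where
  "matrix_fun t (Var v) = t v"
| "matrix_fun t (NVar v) = (\<lambda>a. \<not> t v a)"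
| "matrix_fun t (Conj \<phi>1 \<phi>2) = (\<lambda>a. matrix_fun t \<phi>1 a \<and> matrix_fun t \<phi>2 a)"
| "matrix_fun t (Disj \<phi>1 \<phi>2) = (\<lambda>a. matrix_fun t \<phi>1 a \<or> matrix_fun t \<phi>2 a)"
| "matrix_fun t (Exists v D \<phi>) = matrix_fun t \<phi>"
| "matrix_fun t (Forall v \<phi>) = matrix_fun t \<phi>"

text \<open>Variables outside the domain of the candidate, i.e. the universal ones, stand for
  themselves.\<close>

definition apply_skolem :: "'v set \<Rightarrow> ('v \<Rightarrow> 'v boolfun) \<Rightarrow> 'v dqbf \<Rightarrow> 'v boolfun" where
  "apply_skolem V s \<psi> =
     matrix_fun (\<lambda>v. if v \<in> free_vars V \<psi> \<union> ex_vars \<psi> then s v else (\<lambda>a. a v)) \<psi>"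

definition tautology :: "'v boolfun \<Rightarrow> bool" where
  "tautology f \<longleftrightarrow> (\<forall>a. f a)"

definition skolem_functions :: "'v set \<Rightarrow> 'v dqbf \<Rightarrow> ('v \<Rightarrow> 'v boolfun) set" where
  "skolem_functions V \<psi> = {s \<in> skolem_candidates V \<psi>. tautology (apply_skolem V s \<psi>)}"

definition equisatisfiable :: "'v set \<Rightarrow> 'v dqbf \<Rightarrow> 'v dqbf \<Rightarrow> bool" where
  "equisatisfiable V \<psi>1 \<psi>2 \<longleftrightarrow> (skolem_functions V \<psi>1 = {} \<longleftrightarrow> skolem_functions V \<psi>2 = {})"

primrec subformulas :: "'v dqbf \<Rightarrow> 'v dqbf set" where
  "subformulas (Var v) = {Var v}"
| "subformulas (NVar v) = {NVar v}"
| "subformulas (Conj \<phi>1 \<phi>2) = {Conj \<phi>1 \<phi>2} \<union> subformulas \<phi>1 \<union> subformulas \<phi>2"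
| "subformulas (Disj \<phi>1 \<phi>2) = {Disj \<phi>1 \<phi>2} \<union> subformulas \<phi>1 \<union> subformulas \<phi>2"
| "subformulas (Exists v D \<phi>) = {Exists v D \<phi>} \<union> subformulas \<phi>"
| "subformulas (Forall v \<phi>) = {Forall v \<phi>} \<union> subformulas \<phi>"

text \<open>\<open>replaces_subformula \<alpha> \<beta> \<psi> \<psi>'\<close>: \<open>\<psi>'\<close> results from \<open>\<psi>\<close> by replacing one occurrence of the
  subformula \<open>\<alpha>\<close> by \<open>\<beta>\<close>. A subformula of a well-formed formula that starts with a quantifier
  occurs only once.\<close>

inductive replaces_subformula :: "'v dqbf \<Rightarrow> 'v dqbf \<Rightarrow> 'v dqbf \<Rightarrow> 'v dqbf \<Rightarrow> bool"
  for \<alpha> \<beta> :: "'v dqbf" where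
  here: "replaces_subformula \<alpha> \<beta> \<alpha> \<beta>"
| Conj_left: "replaces_subformula \<alpha> \<beta> \<phi>1 \<phi>1' \<Longrightarrow>
    replaces_subformula \<alpha> \<beta> (Conj \<phi>1 \<phi>2) (Conj \<phi>1' \<phi>2)"
| Conj_right: "replaces_subformula \<alpha> \<beta> \<phi>2 \<phi>2' \<Longrightarrow>
    replaces_subformula \<alpha> \<beta> (Conj \<phi>1 \<phi>2) (Conj \<phi>1 \<phi>2')"
| Disj_left: "replaces_subformula \<alpha> \<beta> \<phi>1 \<phi>1' \<Longrightarrow>
    replaces_subformula \<alpha> \<beta> (Disj \<phi>1 \<phi>2) (Disj \<phi>1' \<phi>2)"
| Disj_right: "replaces_subformula \<alpha> \<beta> \<phi>2 \<phi>2' \<Longrightarrow>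
    replaces_subformula \<alpha> \<beta> (Disj \<phi>1 \<phi>2) (Disj \<phi>1 \<phi>2')"
| Exists_body: "replaces_subformula \<alpha> \<beta> \<phi> \<phi>' \<Longrightarrow>
    replaces_subformula \<alpha> \<beta> (Exists v D \<phi>) (Exists v D \<phi>')"
| Forall_body: "replaces_subformula \<alpha> \<beta> \<phi> \<phi>' \<Longrightarrow>
    replaces_subformula \<alpha> \<beta> (Forall v \<phi>) (Forall v \<phi>')"

lemma ex_replaces_subformula_iff:
  "(\<exists>\<psi>'. replaces_subformula \<alpha> \<beta> \<psi> \<psi>') \<longleftrightarrow> \<alpha> \<in> subformulas \<psi>"
proof
  assume "\<exists>\<psi>'. replaces_subformula \<alpha> \<beta> \<psi> \<psi>'"
  then obtain \<psi>' where "replaces_subformula \<alpha> \<beta> \<psi> \<psi>'" ..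
  then show "\<alpha> \<in> subformulas \<psi>"
    by induction (cases \<alpha>; auto)+
next
  assume "\<alpha> \<in> subformulas \<psi>"
  then show "\<exists>\<psi>'. replaces_subformula \<alpha> \<beta> \<psi> \<psi>'"
    by (induction \<psi>) (auto intro: replaces_subformula.intros)
qed

end

theory Submission
  imports Defs
begin

text \<open>By well-formedness, the quantifier \<open>\<forall>x\<close> is the only place outside the dependency sets of \<open>\<phi>\<close>
  where \<open>x\<close> can be mentioned in \<open>\<psi>\<close>. Hence the two matrices coincide and do not contain \<open>x\<close>. A
  Skolem function for \<open>\<psi>\<close> becomes one for \<open>\<psi>'\<close> by fixing \<open>x\<close> to true in every function (and
  choosing a constant for the now free \<open>x\<close>); a Skolem function for \<open>\<psi>'\<close>, restricted to the
  variables other than \<open>x\<close>, is one for \<open>\<psi>\<close>.\<close>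

lemma ex_vars_remove_dep [simp]: "ex_vars (remove_dep v \<phi>) = ex_vars \<phi>"
  by (induction \<phi>) auto

lemma all_vars_remove_dep [simp]: "all_vars (remove_dep v \<phi>) = all_vars \<phi>"
  by (induction \<phi>) auto

lemma fs_vars_remove_dep [simp]: "fs_vars (remove_dep v \<phi>) = fs_vars \<phi>"
  by (induction \<phi>) auto

lemma q_vars_remove_dep [simp]: "q_vars (remove_dep v \<phi>) = q_vars \<phi>"
  by (simp add: q_vars_def)

lemma dep_remove_dep [simp]: "dep (remove_dep v \<phi>) y = dep \<phi> y - {v}"
  by (induction \<phi>) auto

lemma matrix_fun_remove_dep [simp]: "matrix_fun t (remove_dep v \<phi>) = matrix_fun t \<phi>"
  by (induction \<phi>) auto

lemma remove_dep_commute: "remove_dep v (remove_dep w \<phi>) = remove_dep w (remove_dep v \<phi>)"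
  by (induction \<phi>) auto

lemma dep_outside_ex_vars: "y \<notin> ex_vars \<phi> \<Longrightarrow> dep \<phi> y = {}"
  by (induction \<phi>) auto

lemma separated_remove_dep:
  "separated \<phi>1 \<phi>2 \<Longrightarrow> separated (remove_dep v \<phi>1) (remove_dep v \<phi>2)"
  by (auto simp: separated_def)

text \<open>Deletions commute, so an existential node over \<open>remove_dep w \<phi>\<close> is
  rebuilt over \<open>remove_dep v \<phi>\<close>, and the side conditions survive because
  dependency sets only shrink.\<close>

lemma remove_dep_dqbfs: "\<phi> \<in> dqbfs V \<Longrightarrow> remove_dep v \<phi> \<in> dqbfs V"
proof (induction rule: dqbfs.induct)
  case (Exists \<phi> w D)
  have "Exists w (D - {v}) (remove_dep w (remove_dep v \<phi>)) \<in> dqbfs V"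
    using Exists by (intro dqbfs.Exists) (auto simp: free_vars_def)
  then show ?case
    by (simp add: remove_dep_commute)
qed (auto intro: dqbfs.intros separated_remove_dep simp: free_vars_def)

lemma dqbfs_ConjD:
  assumes "Conj \<phi>1 \<phi>2 \<in> dqbfs V"
  shows "\<phi>1 \<in> dqbfs V" "\<phi>2 \<in> dqbfs V" "separated \<phi>1 \<phi>2" "separated \<phi>2 \<phi>1"
  using assms by (auto elim: dqbfs.cases)

lemma dqbfs_DisjD:
  assumes "Disj \<phi>1 \<phi>2 \<in> dqbfs V"
  shows "\<phi>1 \<in> dqbfs V" "\<phi>2 \<in> dqbfs V" "separated \<phi>1 \<phi>2" "separated \<phi>2 \<phi>1"
  using assms by (auto elim: dqbfs.cases)

text \<open>The formation rule only gives a body of the form \<open>remove_dep v \<phi>\<close> with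
  \<open>\<phi>\<close> well-formed; closure of \<open>dqbfs V\<close> under
  \<open>remove_dep\<close> makes the body itself well-formed, so an induction can descend into
  it.\<close>

lemma dqbfs_ExistsD:
  assumes "Exists v D \<phi> \<in> dqbfs V"
  shows "\<phi> \<in> dqbfs V" "v \<notin> q_vars \<phi>" "D \<inter> q_vars \<phi> = {}"
  using assms by (auto elim!: dqbfs.cases[of "Exists v D \<phi>"] simp: remove_dep_dqbfs free_vars_def)

lemma dqbfs_ForallD:
  assumes "Forall v \<phi> \<in> dqbfs V"
  shows "\<phi> \<in> dqbfs V" "v \<in> V" "v \<notin> q_vars \<phi>"
  using assms by (auto elim: dqbfs.cases simp: free_vars_def)

text \<open>At a binary node with the quantifier of \<open>x\<close> in one branch, this lets the
  other branch count as untouched: taking \<open>x\<close> out of its dependency sets changes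
  nothing.\<close>

lemma separated_fresh:
  assumes "separated \<phi>1 \<phi>2" and "x \<in> q_vars \<phi>2"
  shows "x \<notin> ex_vars \<phi>1" "x \<notin> all_vars \<phi>1" "x \<notin> fs_vars \<phi>1" "x \<notin> dep \<phi>1 y"
  using assms dep_outside_ex_vars[of y \<phi>1] by (auto simp: separated_def q_vars_def)

text \<open>Induction along the path down to the replaced quantifier. The equation for
  \<open>all_vars\<close> doubles as the record that \<open>x\<close> is quantified in the part
  containing that quantifier, which is what the separation conditions need.\<close>

lemma replace_vacuous_Forall:
  assumes "replaces_subformula (Forall x \<phi>) (remove_dep x \<phi>) \<psi> \<psi>'"
    and "x \<notin> vars \<phi>" and "\<psi> \<in> dqbfs V"
  shows "x \<in> V \<and> ex_vars \<psi>' = ex_vars \<psi> \<and> all_vars \<psi> = insert x (all_vars \<psi>') \<and> x \<notin> vars \<psi>' \<and>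
    (\<forall>y. dep \<psi>' y = dep \<psi> y - {x}) \<and> (\<forall>t. matrix_fun t \<psi>' = matrix_fun t \<psi>)"
  using assms
proof (induction rule: replaces_subformula.induct)
  case here
  then show ?case
    using dqbfs_ForallD[of x \<phi> V] by (auto simp: vars_def q_vars_def)
next
  case (Conj_left \<phi>1 \<phi>1' \<phi>2)
  note wf = dqbfs_ConjD[OF Conj_left.prems(2)]
  note IH = Conj_left.IH[OF Conj_left.prems(1) wf(1)]
  have "x \<in> q_vars \<phi>1" using IH by (auto simp: q_vars_def)
  note fresh = separated_fresh[OF wf(4) this]
  show ?case using IH fresh by (auto simp: vars_def q_vars_def)
next
  case (Conj_right \<phi>2 \<phi>2' \<phi>1)
  note wf = dqbfs_ConjD[OF Conj_right.prems(2)]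
  note IH = Conj_right.IH[OF Conj_right.prems(1) wf(2)]
  have "x \<in> q_vars \<phi>2" using IH by (auto simp: q_vars_def)
  note fresh = separated_fresh[OF wf(3) this]
  show ?case using IH fresh by (auto simp: vars_def q_vars_def)
next
  case (Disj_left \<phi>1 \<phi>1' \<phi>2)
  note wf = dqbfs_DisjD[OF Disj_left.prems(2)]
  note IH = Disj_left.IH[OF Disj_left.prems(1) wf(1)]
  have "x \<in> q_vars \<phi>1" using IH by (auto simp: q_vars_def)
  note fresh = separated_fresh[OF wf(4) this]
  show ?case using IH fresh by (auto simp: vars_def q_vars_def)
next
  case (Disj_right \<phi>2 \<phi>2' \<phi>1)
  note wf = dqbfs_DisjD[OF Disj_right.prems(2)]
  note IH = Disj_right.IH[OF Disj_right.prems(1) wf(2)]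
  have "x \<in> q_vars \<phi>2" using IH by (auto simp: q_vars_def)
  note fresh = separated_fresh[OF wf(3) this]
  show ?case using IH fresh by (auto simp: vars_def q_vars_def)
next
  case (Exists_body \<chi> \<chi>' v D)
  note wf = dqbfs_ExistsD[OF Exists_body.prems(2)]
  note IH = Exists_body.IH[OF Exists_body.prems(1) wf(1)]
  \<comment> \<open>As \<open>x\<close> is quantified in \<open>\<chi>\<close>, well-formedness
    gives \<open>v \<noteq> x\<close> and \<open>x \<notin> D\<close>, hence
    \<open>D = D - {x}\<close>.\<close>
  show ?case using IH wf(2,3) by (auto simp: vars_def q_vars_def)
next
  case (Forall_body \<chi> \<chi>' v)
  note wf = dqbfs_ForallD[OF Forall_body.prems(2)]
  note IH = Forall_body.IH[OF Forall_body.prems(1) wf(1)]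
  show ?case using IH wf(3) by (auto simp: vars_def q_vars_def)
qed

text \<open>Substitution and assignment may vary together, so that a value at \<open>a\<close> can
  be compared with one at \<open>a(x := True)\<close>.\<close>

lemma matrix_fun_cong:
  assumes "\<And>v. v \<in> vars \<psi> \<Longrightarrow> t v a = t' v a'"
  shows "matrix_fun t \<psi> a = matrix_fun t' \<psi> a'"
  using assms by (induction \<psi>) (auto simp: vars_def q_vars_def)

lemma supp_fix: "supp (\<lambda>a. f (a(x := b))) \<subseteq> supp f - {x}"
proof
  fix v assume "v \<in> supp (\<lambda>a. f (a(x := b)))"
  then obtain a where a: "f (a(v := True, x := b)) \<noteq> f (a(v := False, x := b))"
    by (auto simp: supp_def)
  then have "v \<noteq> x" by auto
  \<comment> \<open>Updates at distinct variables commute, so \<open>a(x := b)\<close> witnesses the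
    dependence of \<open>f\<close> on \<open>v\<close>.\<close>
  with a have "f ((a(x := b))(v := True)) \<noteq> f ((a(x := b))(v := False))"
    by (simp add: fun_upd_twist)
  with \<open>v \<noteq> x\<close> show "v \<in> supp f - {x}"
    unfolding supp_def by blast
qed

lemma boolfuns_fix: "f \<in> boolfuns (insert x W) \<Longrightarrow> (\<lambda>a. f (a(x := b))) \<in> boolfuns W"
  by (auto simp: boolfuns_def)

lemma boolfuns_mono: "W \<subseteq> W' \<Longrightarrow> boolfuns W \<subseteq> boolfuns W'"
  unfolding boolfuns_def by blast

theorem theorem6:
  fixes V :: "'v set" and \<psi> \<psi>' \<phi> :: "'v dqbf" and x :: 'v
  assumes "finite V"
    and "\<psi> \<in> dqbfs V"
    and "Forall x \<phi> \<in> subformulas \<psi>"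
    and "x \<notin> vars \<phi>"
    and "replaces_subformula (Forall x \<phi>) (remove_dep x \<phi>) \<psi> \<psi>'"
  shows "equisatisfiable V \<psi> \<psi>'"
proof -
  have "x \<in> V" and ex: "ex_vars \<psi>' = ex_vars \<psi>"
    and all: "all_vars \<psi> = insert x (all_vars \<psi>')" and x: "x \<notin> vars \<psi>'"
    and dep: "\<And>y. dep \<psi>' y = dep \<psi> y - {x}"
    and matrix: "\<And>t. matrix_fun t \<psi>' = matrix_fun t \<psi>"
    using replace_vacuous_Forall[OF assms(5,4,2)] by auto
  have x_notin: "x \<notin> ex_vars \<psi>" "x \<notin> all_vars \<psi>'" "x \<notin> free_vars V \<psi>"
    using x all by (auto simp: vars_def q_vars_def ex free_vars_def)
  \<comment> \<open>Over the fixed set \<open>V\<close>, losing its quantifier turns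
    \<open>x\<close> into a free variable, so candidates for \<open>\<psi>'\<close> have exactly one
    more argument.\<close>
  have free: "free_vars V \<psi>' = insert x (free_vars V \<psi>)"
    using \<open>x \<in> V\<close> x_notin by (auto simp: free_vars_def q_vars_def all ex)
  let ?dom = "free_vars V \<psi> \<union> ex_vars \<psi>"
  have "skolem_functions V \<psi>' \<noteq> {}" if "s \<in> skolem_functions V \<psi>" for s
  proof -
    have s: "s \<in> ?dom \<rightarrow>\<^sub>E boolfuns (insert x (all_vars \<psi>'))"
      and const: "\<And>v. v \<in> free_vars V \<psi> \<Longrightarrow> \<exists>c. s v = (\<lambda>_. c)"
      and supp: "\<And>v. v \<in> ex_vars \<psi> \<Longrightarrow> supp (s v) \<subseteq> dep \<psi> v \<inter> all_vars \<psi>"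
      and taut: "\<And>a. apply_skolem V s \<psi> a"
      using that by (auto simp: skolem_functions_def skolem_candidates_def tautology_def all)
    \<comment> \<open>The value at \<open>x\<close> may be any constant, since \<open>x\<close> does
      not occur in \<open>\<psi>'\<close>; \<open>undefined\<close> keeps \<open>s'\<close>
      extensional.\<close>
    define s' where "s' v = (if v = x then (\<lambda>_. True)
      else if v \<in> ?dom then (\<lambda>a. s v (a(x := True))) else undefined)" for v
    have "s' \<in> (free_vars V \<psi>' \<union> ex_vars \<psi>') \<rightarrow>\<^sub>E boolfuns (all_vars \<psi>')"
    proof (rule PiE_I)
      fix v assume "v \<in> free_vars V \<psi>' \<union> ex_vars \<psi>'"
      then show "s' v \<in> boolfuns (all_vars \<psi>')"
        using boolfuns_fix[OF PiE_mem[OF s, of v]]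
        by (cases "v = x") (auto simp: s'_def free ex boolfuns_def)
    qed (auto simp: s'_def free ex)
    moreover have "\<exists>c. s' v = (\<lambda>_. c)" if v: "v \<in> free_vars V \<psi>'" for v
    proof (cases "v = x")
      case False
      then obtain c where "s v = (\<lambda>_. c)"
        using v const[of v] by (auto simp: free)
      then have "s' v = (\<lambda>_. c)"
        using v False by (simp add: s'_def free)
      then show ?thesis ..
    qed (auto simp: s'_def)
    moreover have "supp (s' v) \<subseteq> dep \<psi>' v \<inter> all_vars \<psi>'" if "v \<in> ex_vars \<psi>'" for v
    proof -
      have "s' v = (\<lambda>a. s v (a(x := True)))"
        using that x_notin by (auto simp: s'_def ex)
      then show ?thesis
        using that supp_fix[of "s v" x True] supp[of v] by (auto simp: dep all ex)
    qed
    moreover have "apply_skolem V s' \<psi>' a" for a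
    proof -
      \<comment> \<open>With both matrices written as that of \<open>\<psi>'\<close>, every variable
        read is different from \<open>x\<close>: universal ones agree under both assignments, the
        others by the choice of \<open>s'\<close>.\<close>
      have "apply_skolem V s' \<psi>' a = apply_skolem V s \<psi> (a(x := True))"
        unfolding apply_skolem_def matrix[symmetric]
        by (rule matrix_fun_cong) (use x in \<open>auto simp: s'_def free ex\<close>)
      then show ?thesis using taut by simp
    qed
    ultimately have "s' \<in> skolem_functions V \<psi>'"
      by (auto simp: skolem_functions_def skolem_candidates_def tautology_def)
    then show ?thesis by auto
  qed
  moreover have "skolem_functions V \<psi> \<noteq> {}" if "s \<in> skolem_functions V \<psi>'" for s
  proof -
    have s: "s \<in> insert x ?dom \<rightarrow>\<^sub>E boolfuns (all_vars \<psi>')"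
      and const: "\<And>v. v \<in> free_vars V \<psi> \<Longrightarrow> \<exists>c. s v = (\<lambda>_. c)"
      and supp: "\<And>v. v \<in> ex_vars \<psi> \<Longrightarrow> supp (s v) \<subseteq> dep \<psi>' v \<inter> all_vars \<psi>'"
      and taut: "\<And>a. apply_skolem V s \<psi>' a"
      using that by (auto simp: skolem_functions_def skolem_candidates_def tautology_def free ex)
    \<comment> \<open>In \<open>\<psi>\<close> the variable \<open>x\<close> is universal, so a
      candidate must be \<open>undefined\<close> there.\<close>
    define s' where "s' = restrict s ?dom"
    have "s' \<in> ?dom \<rightarrow>\<^sub>E boolfuns (all_vars \<psi>)"
      using s boolfuns_mono[of "all_vars \<psi>'" "all_vars \<psi>"] by (auto simp: s'_def all)
    moreover have "\<exists>c. s' v = (\<lambda>_. c)" if "v \<in> free_vars V \<psi>" for v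
      using that const[of v] by (auto simp: s'_def)
    moreover have "supp (s' v) \<subseteq> dep \<psi> v \<inter> all_vars \<psi>" if "v \<in> ex_vars \<psi>" for v
      using that supp[of v] by (auto simp: s'_def dep all)
    moreover have "apply_skolem V s' \<psi> a" for a
    proof -
      \<comment> \<open>The two substitutions can differ only at \<open>x\<close>, which stands for
        itself in one and for \<open>s x\<close> in the other and is never read.\<close>
      have "apply_skolem V s' \<psi> a = apply_skolem V s \<psi>' a"
        unfolding apply_skolem_def matrix[symmetric]
        by (rule matrix_fun_cong) (use x in \<open>auto simp: s'_def free ex\<close>)
      then show ?thesis using taut by simp
    qed
    ultimately have "s' \<in> skolem_functions V \<psi>"
      by (auto simp: skolem_functions_def skolem_candidates_def tautology_def)
    then show ?thesis by auto
  qed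
  ultimately show ?thesis
    unfolding equisatisfiable_def by blast
qed

end
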